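(* Let $G_1$ be a graph with vertices $a_1,\dots,a_n$, let $G_2$ be a graph with vertices $b_1,\dots,b_m$, and let $H=G_1\odot G_2$ be their corona. In $H$ there are $n$ copies of $G_2$; let the vertices of the $i$-th copy be $b_{i1},b_{i2},\dots,b_{im}$, where $b_{ij}$ is the copy of $b_j$. Then $${}_{H}d_d(a)=\begin{cases} n & \text{if } a=a_i,\ i=1,\dots,n,\\ {}_{G_2}d_d(b_j)+(n-1) & \text{if } a=b_{ij},\ i=1,\dots,n \text{ and } j=1,\dots,m.\end{cases}$$
   Context: Graphs are finite, simple and undirected, with nonempty vertex set. A dominating set of a graph $F$ is a set $D\subseteq V(F)$ such that every vertex in $V(F)\setminus D$ is adjacent to some vertex of $D$. A minimal dominating set is a dominating set that does not properly contain any other dominating set. The domination degree of a vertex $v$ in $F$ is ${}_{F}d_d(v)=\min\{|D| : D \text{ is a minimal dominating set of } F \text{ with } v\in D\}$. The corona $G_1\odot G_2$ is obtained from $G_1$ and $|V(G_1)|$ disjoint copies of $G_2$ by joining the $i$-th vertex of $G_1$ to every vertex of the $i$-th copy of $G_2$. *)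

theory Defs
  imports "Graph_Theory.Pair_Digraph"
begin

text \<open>
  A finite simple undirected graph is a \<^locale>\<open>pair_graph\<close>: finitely many vertices, no loops, at most
  one arc per ordered pair, and a symmetric arc relation, so that every edge occurs as an arc in both
  directions. This locale admits the empty graph; where needed, nonemptiness is assumed separately.
\<close>

definition dominating_set :: "'a pair_pre_digraph \<Rightarrow> 'a set \<Rightarrow> bool" where
  "dominating_set F D \<longleftrightarrow>
     D \<subseteq> pverts F \<and> (\<forall>v \<in> pverts F - D. \<exists>u \<in> D. (v, u) \<in> parcs F)"

definition minimal_dominating_set :: "'a pair_pre_digraph \<Rightarrow> 'a set \<Rightarrow> bool" where
  "minimal_dominating_set F D \<longleftrightarrow> dominating_set F D \<and> (\<forall>D'. D' \<subset> D \<longrightarrow> \<not> dominating_set F D')"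

definition dom_degree :: "'a pair_pre_digraph \<Rightarrow> 'a \<Rightarrow> nat" where
  "dom_degree F v = Min {card D | D. minimal_dominating_set F D \<and> v \<in> D}"

text \<open>
  The copies of \<open>G2\<close> are indexed by the vertices of \<open>G1\<close>: \<open>Inl a\<close> is the vertex \<open>a\<close> of
  \<open>G1\<close>, and \<open>Inr (a, b)\<close> is the copy of the vertex \<open>b\<close> of \<open>G2\<close> in the copy that is attached to \<open>a\<close>.
\<close>

definition corona ::
  "'a pair_pre_digraph \<Rightarrow> 'b pair_pre_digraph \<Rightarrow> ('a + 'a \<times> 'b) pair_pre_digraph" where
  "corona G1 G2 =
     \<lparr> pverts = Inl ` pverts G1 \<union> Inr ` (pverts G1 \<times> pverts G2),
       parcs = {(Inl a, Inl a') | a a'. (a, a') \<in> parcs G1}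
             \<union> {(Inr (a, b), Inr (a, b')) | a b b'. a \<in> pverts G1 \<and> (b, b') \<in> parcs G2}
             \<union> {(Inl a, Inr (a, b)) | a b. a \<in> pverts G1 \<and> b \<in> pverts G2}
             \<union> {(Inr (a, b), Inl a) | a b. a \<in> pverts G1 \<and> b \<in> pverts G2} \<rparr>"

lemma pair_graph_corona:
  assumes "pair_graph G1" "pair_graph G2"
  shows "pair_graph (corona G1 G2)"
proof -
  interpret G1: pair_graph G1 by fact
  interpret G2: pair_graph G2 by fact
  let ?H = "corona G1 G2"
  have fin: "finite (pverts ?H)"
    by (simp add: corona_def)
  have wf: "parcs ?H \<subseteq> pverts ?H \<times> pverts ?H"
    by (auto simp: corona_def dest: G1.arc_fst_in_verts G1.arc_snd_in_verts
        G2.arc_fst_in_verts G2.arc_snd_in_verts)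
  have sym: "sym (parcs ?H)"
    by (rule symI) (auto simp: corona_def intro: G1.arcs_symmetric G2.arcs_symmetric)
  have irr: "(x, x) \<notin> parcs ?H" for x
    using G1.pair_no_loops G2.pair_no_loops by (force simp: corona_def)
  show ?thesis
  proof unfold_locales
    show "finite (parcs ?H)"
      using wf fin by (meson finite_SigmaI finite_subset)
    show "symmetric (with_proj ?H)"
      using sym by (simp add: symmetric_def arcs_ends_def arc_to_ends_def)
  qed (use fin wf irr in auto)
qed

text \<open>
  The minimum in \<^const>\<open>dom_degree\<close> is over a finite nonempty set: a maximal independent set that
  contains \<open>v\<close> is a minimal dominating set.
\<close>

lemma dom_degree_well_defined:
  assumes "pair_graph F" "v \<in> pverts F"
  shows "finite {card D | D. minimal_dominating_set F D \<and> v \<in> D}"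
    and "{card D | D. minimal_dominating_set F D \<and> v \<in> D} \<noteq> {}"
proof -
  interpret pair_graph F by fact
  have "{card D | D. minimal_dominating_set F D \<and> v \<in> D} \<subseteq> card ` Pow (pverts F)"
    by (auto simp: minimal_dominating_set_def dominating_set_def)
  then show "finite {card D | D. minimal_dominating_set F D \<and> v \<in> D}"
    by (rule finite_subset) simp
  define I where "I = {D. D \<subseteq> pverts F \<and> v \<in> D \<and> (\<forall>x\<in>D. \<forall>y\<in>D. (x, y) \<notin> parcs F)}"
  have "finite I"
    by (rule finite_subset[of _ "Pow (pverts F)"]) (auto simp: I_def)
  moreover have "{v} \<in> I"
    using assms(2) pair_no_loops by (force simp: I_def)
  ultimately obtain D where D: "D \<in> I" and max: "\<And>E. E \<in> I \<Longrightarrow> D \<subseteq> E \<Longrightarrow> E = D"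
    using finite_has_maximal[of I] by (metis empty_iff)
  have "\<exists>u\<in>D. (w, u) \<in> parcs F" if w: "w \<in> pverts F - D" for w
  proof (rule ccontr)
    assume no: "\<not> (\<exists>u\<in>D. (w, u) \<in> parcs F)"
    have "(w, w) \<notin> parcs F" using pair_no_loops by force
    with D w no have "insert w D \<in> I" by (auto simp: I_def dest: arcs_symmetric)
    with max w show False by blast
  qed
  then have "dominating_set F D"
    using D by (auto simp: dominating_set_def I_def)
  moreover have "\<not> dominating_set F D'" if "D' \<subset> D" for D'
    using that D unfolding dominating_set_def I_def by blast
  ultimately have "minimal_dominating_set F D"
    by (simp add: minimal_dominating_set_def)
  with D show "{card D | D. minimal_dominating_set F D \<and> v \<in> D} \<noteq> {}"
    by (auto simp: I_def)
qed

end

theory Submission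
  imports Defs
begin

text \<open>
  A vertex of the corona lies in the block of exactly one vertex \<open>x\<close> of \<open>G1\<close>, which consists of \<open>x\<close>
  and of the copy of \<open>G2\<close> attached to it. No edge leaves a copy of \<open>G2\<close> except towards its own \<open>x\<close>, so
  domination is decided block by block: a set dominates the corona exactly if in every block it
  contains \<open>x\<close> or dominates the copy of \<open>G2\<close> (\<open>dominating_set_corona_iff\<close>). In the second case \<open>x\<close> is
  dominated as well, because a dominating set of a nonempty graph is nonempty.

  Consequently a minimal dominating set of the corona is an independent choice, for every block, of
  either \<open>x\<close> alone or a minimal dominating set of the copy of \<open>G2\<close>
  (\<open>minimal_dominating_set_corona_iff\<close>), and its cardinality is the sum of the sizes of these choices.
  Every block costs at least 1, and \<open>x\<close> alone costs exactly 1. If the set has to contain a vertex of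
  \<open>G1\<close>, all blocks can be served at this price. If it has to contain the copy of \<open>y\<close> in one block,
  then \<open>x\<close> is ruled out there, so that block costs at least the domination degree of \<open>y\<close> in \<open>G2\<close>,
  while the others still cost 1 each.
\<close>

section \<open>Domination degree\<close>

lemma dominating_set_nonempty:
  assumes "dominating_set F D" "pverts F \<noteq> {}"
  shows "D \<noteq> {}"
  using assms by (auto simp: dominating_set_def)

lemma dom_degree_le_card:
  assumes "pair_graph F" "v \<in> pverts F" "minimal_dominating_set F D" "v \<in> D"
  shows "dom_degree F v \<le> card D"
  unfolding dom_degree_def
  using dom_degree_well_defined(1)[OF assms(1,2)] assms(3,4) by (intro Min_le) auto

lemma dom_degree_attained:
  assumes "pair_graph F" "v \<in> pverts F"
  obtains D where "minimal_dominating_set F D" "v \<in> D" "card D = dom_degree F v"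
  using Min_in[OF dom_degree_well_defined[OF assms]] that
  unfolding dom_degree_def by auto

lemma dom_degree_eqI:
  assumes "pair_graph F" "v \<in> pverts F" "minimal_dominating_set F D" "v \<in> D" "card D = k"
    and "\<And>E. minimal_dominating_set F E \<Longrightarrow> v \<in> E \<Longrightarrow> k \<le> card E"
  shows "dom_degree F v = k"
  using dom_degree_le_card[OF assms(1-4)] dom_degree_attained[OF assms(1,2)] assms(5,6)
  by (metis le_antisym)

section \<open>Dominating sets of a corona\<close>

definition copy_trace :: "('a + 'a \<times> 'b) set \<Rightarrow> 'a \<Rightarrow> 'b set" where
  "copy_trace D x = {y. Inr (x, y) \<in> D}"

lemma mem_copy_trace [simp]: "y \<in> copy_trace D x \<longleftrightarrow> Inr (x, y) \<in> D"
  by (simp add: copy_trace_def)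

lemma copy_trace_mono: "D \<subseteq> E \<Longrightarrow> copy_trace D x \<subseteq> copy_trace E x"
  by auto

lemma verts_corona:
  "Inl x \<in> pverts (corona G1 G2) \<longleftrightarrow> x \<in> pverts G1"
  "Inr (x, y) \<in> pverts (corona G1 G2) \<longleftrightarrow> x \<in> pverts G1 \<and> y \<in> pverts G2"
  by (auto simp: corona_def)

lemma corona_subsetD:
  assumes "D \<subseteq> pverts (corona G1 G2)"
  shows "Inl x \<in> D \<Longrightarrow> x \<in> pverts G1"
    and "Inr (x, y) \<in> D \<Longrightarrow> x \<in> pverts G1"
    and "Inr (x, y) \<in> D \<Longrightarrow> y \<in> pverts G2"
  by (metis assms subsetD verts_corona)+

lemma copy_trace_subset:
  assumes "D \<subseteq> pverts (corona G1 G2)"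
  shows "copy_trace D x \<subseteq> pverts G2"
  using corona_subsetD(3)[OF assms] by auto

text \<open>
  The neighbours of a copy vertex stay inside its block, which makes the condition necessary. It is
  sufficient because a dominating set of the nonempty graph \<open>G2\<close> has a member, and this member is
  adjacent to the centre of its block.
\<close>

lemma dominating_set_corona_iff:
  assumes "pverts G2 \<noteq> {}"
  shows "dominating_set (corona G1 G2) D \<longleftrightarrow>
    D \<subseteq> pverts (corona G1 G2) \<and>
    (\<forall>x \<in> pverts G1. Inl x \<in> D \<or> dominating_set G2 (copy_trace D x))"
proof (intro iffI conjI ballI)
  assume dom: "dominating_set (corona G1 G2) D"
  then show sub: "D \<subseteq> pverts (corona G1 G2)"
    by (simp add: dominating_set_def)
  fix x assume x: "x \<in> pverts G1"
  have "dominating_set G2 (copy_trace D x)" if "Inl x \<notin> D"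
    unfolding dominating_set_def
  proof (intro conjI ballI)
    show "copy_trace D x \<subseteq> pverts G2"
      using sub by (rule copy_trace_subset)
    fix y assume y: "y \<in> pverts G2 - copy_trace D x"
    then have "Inr (x, y) \<in> pverts (corona G1 G2) - D"
      using x by (simp add: verts_corona)
    then obtain u where "u \<in> D" "(Inr (x, y), u) \<in> parcs (corona G1 G2)"
      using dom unfolding dominating_set_def by blast
    with that show "\<exists>u\<in>copy_trace D x. (y, u) \<in> parcs G2"
      by (auto simp: corona_def)
  qed
  then show "Inl x \<in> D \<or> dominating_set G2 (copy_trace D x)"
    by blast
next
  assume D: "D \<subseteq> pverts (corona G1 G2) \<and>
    (\<forall>x \<in> pverts G1. Inl x \<in> D \<or> dominating_set G2 (copy_trace D x))"
  show "dominating_set (corona G1 G2) D"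
    unfolding dominating_set_def
  proof (intro conjI ballI)
    show "D \<subseteq> pverts (corona G1 G2)" using D by blast
    fix w assume w: "w \<in> pverts (corona G1 G2) - D"
    show "\<exists>u\<in>D. (w, u) \<in> parcs (corona G1 G2)"
    proof (cases w)
      case (Inl x)
      with w have x: "x \<in> pverts G1" and "Inl x \<notin> D"
        by (simp_all add: verts_corona)
      with D have dom: "dominating_set G2 (copy_trace D x)"
        by blast
      obtain y where y: "Inr (x, y) \<in> D"
        using dominating_set_nonempty[OF dom assms] by auto
      then have "y \<in> pverts G2"
        using D corona_subsetD(3) by metis
      with x y Inl show ?thesis
        by (intro bexI[of _ "Inr (x, y)"]) (auto simp: corona_def)
    next
      case (Inr p)
      then obtain x y where p: "w = Inr (x, y)" by (cases p) auto
      with w have xy: "x \<in> pverts G1" "y \<in> pverts G2" "y \<notin> copy_trace D x"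
        by (auto simp: verts_corona)
      show ?thesis
      proof (cases "Inl x \<in> D")
        case True
        with xy p show ?thesis
          by (intro bexI[of _ "Inl x"]) (auto simp: corona_def)
      next
        case False
        with D xy(1) have "dominating_set G2 (copy_trace D x)"
          by blast
        with xy obtain u where "Inr (x, u) \<in> D" "(y, u) \<in> parcs G2"
          unfolding dominating_set_def by fastforce
        with xy p show ?thesis
          by (intro bexI[of _ "Inr (x, u)"]) (auto simp: corona_def)
      qed
    qed
  qed
qed

text \<open>
  The two alternatives of the domination condition exclude each other in a minimal set: next to the
  centre of a block every copy vertex of that block can be dropped. Since the condition treats the
  blocks independently, minimality can be tested by shrinking one block at a time.
\<close>

lemma minimal_dominating_set_corona_iff:
  assumes "pverts G2 \<noteq> {}"
  shows "minimal_dominating_set (corona G1 G2) D \<longleftrightarrow>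
    D \<subseteq> pverts (corona G1 G2) \<and>
    (\<forall>x \<in> pverts G1. if Inl x \<in> D then copy_trace D x = {}
                     else minimal_dominating_set G2 (copy_trace D x))"
    (is "?min \<longleftrightarrow> ?sub \<and> (\<forall>x \<in> pverts G1. ?block x)")
proof (intro iffI conjI ballI)
  assume min: ?min
  then have dom: "dominating_set (corona G1 G2) D"
    by (simp add: minimal_dominating_set_def)
  then show sub: ?sub
    by (simp add: dominating_set_def)
  fix x assume x: "x \<in> pverts G1"
  define D' where "D' T = D - range (\<lambda>y. Inr (x, y)) \<union> (\<lambda>y. Inr (x, y)) ` T" for T
  have D'_trace: "copy_trace (D' T) z = (if z = x then T else copy_trace D z)" for T z
    by (auto simp: D'_def)
  have D'_less: "D' T \<subset> D" if T: "T \<subset> copy_trace D x" for T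
  proof (rule psubsetI)
    show "D' T \<subseteq> D"
      using T by (auto simp: D'_def)
    show "D' T \<noteq> D"
      using D'_trace[of T x] T by auto
  qed
  have D'_dom: "dominating_set (corona G1 G2) (D' T)"
    if T: "T \<subset> copy_trace D x" and ok: "Inl x \<in> D \<or> dominating_set G2 T" for T
  proof -
    have "Inl z \<in> D' T \<longleftrightarrow> Inl z \<in> D" for z
      by (auto simp: D'_def)
    then show ?thesis
      using dom ok D'_less[OF T] D'_trace unfolding dominating_set_corona_iff[OF assms]
      by (metis order.strict_implies_order order_trans)
  qed
  have no_less: "\<not> (Inl x \<in> D \<or> dominating_set G2 T)" if "T \<subset> copy_trace D x" for T
    using min D'_less[OF that] D'_dom[OF that] unfolding minimal_dominating_set_def by blast
  show "?block x"
  proof (cases "Inl x \<in> D")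
    case True
    then have "\<not> {} \<subset> copy_trace D x"
      using no_less by metis
    with True show ?thesis
      by (simp add: psubset_eq eq_commute[of "{}"])
  next
    case False
    then have "dominating_set G2 (copy_trace D x)"
      using dom x unfolding dominating_set_corona_iff[OF assms] by blast
    with False show ?thesis
      using no_less by (simp add: minimal_dominating_set_def)
  qed
next
  assume D: "?sub \<and> (\<forall>x \<in> pverts G1. ?block x)"
  have dom: "dominating_set (corona G1 G2) D"
    using D unfolding dominating_set_corona_iff[OF assms] minimal_dominating_set_def by metis
  have "\<not> dominating_set (corona G1 G2) D'" if less: "D' \<subset> D" for D'
  proof
    assume "dominating_set (corona G1 G2) D'"
    then have D': "Inl x \<in> D' \<or> dominating_set G2 (copy_trace D' x)" if "x \<in> pverts G1" for x
      using that unfolding dominating_set_corona_iff[OF assms] by simp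
    obtain z where z: "z \<in> D" "z \<notin> D'" using less by blast
    show False
    proof (cases z)
      case (Inl x)
      with z D have x: "x \<in> pverts G1"
        using corona_subsetD(1) by metis
      with Inl z D have "copy_trace D x = {}" by metis
      moreover have "copy_trace D' x \<subseteq> copy_trace D x"
        using less by (intro copy_trace_mono) simp
      ultimately have "\<not> dominating_set G2 (copy_trace D' x)"
        using dominating_set_nonempty[OF _ assms] by (metis subset_empty)
      with D'[OF x] Inl z show False
        by simp
    next
      case (Inr p)
      then obtain x y where p: "z = Inr (x, y)" by (cases p) auto
      with z D have x: "x \<in> pverts G1"
        using corona_subsetD(2) by metis
      have y: "y \<in> copy_trace D x" "y \<notin> copy_trace D' x" using p z by auto
      with D x have notin: "Inl x \<notin> D" and min: "minimal_dominating_set G2 (copy_trace D x)"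
        by (metis empty_iff)+
      have "copy_trace D' x \<subset> copy_trace D x"
        using y copy_trace_mono[of D' D x] less by (metis psubset_imp_subset psubsetI)
      moreover have "dominating_set G2 (copy_trace D' x)"
        using D'[OF x] notin less by (metis psubsetD)
      ultimately show False
        using min unfolding minimal_dominating_set_def by blast
    qed
  qed
  with dom show ?min
    by (simp add: minimal_dominating_set_def)
qed

lemma card_corona_subset:
  assumes "pair_graph G1" "pair_graph G2" "D \<subseteq> pverts (corona G1 G2)"
  shows "card D =
    (\<Sum>x\<in>pverts G1. (if Inl x \<in> D then 1 else 0) + card (copy_trace D x))"
proof -
  interpret G1: pair_graph G1 by fact
  interpret G2: pair_graph G2 by fact
  have fin: "finite (copy_trace D x)" for x
    using copy_trace_subset[OF assms(3)] by (rule finite_subset) simp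
  have D: "D = Inl ` {x \<in> pverts G1. Inl x \<in> D} \<union> Inr ` Sigma (pverts G1) (copy_trace D)"
    (is "_ = ?L \<union> ?R")
    using assms(3) by (auto simp: corona_def)
  have "card D = card ?L + card ?R"
    by (subst D, rule card_Un_disjoint) (auto simp: fin)
  also have "card ?L = (\<Sum>x\<in>pverts G1. if Inl x \<in> D then 1 else 0)"
    by (simp add: card_image sum.If_cases Int_def)
  also have "card ?R = (\<Sum>x\<in>pverts G1. card (copy_trace D x))"
    by (simp add: card_image fin)
  finally show ?thesis by (simp add: sum.distrib)
qed

lemma minimal_corona_block_ge_1:
  assumes "pair_graph G2" "pverts G2 \<noteq> {}" "minimal_dominating_set (corona G1 G2) D"
    and "x \<in> pverts G1"
  shows "1 \<le> (if Inl x \<in> D then 1 else 0) + card (copy_trace D x)"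
proof (cases "Inl x \<in> D")
  case False
  interpret G2: pair_graph G2 by fact
  have dom: "dominating_set G2 (copy_trace D x)"
    using assms(3,4) False minimal_dominating_set_corona_iff[OF assms(2)]
    unfolding minimal_dominating_set_def by metis
  then have "finite (copy_trace D x)"
    unfolding dominating_set_def using finite_subset G2.pair_finite_verts by blast
  with dominating_set_nonempty[OF dom assms(2)] show ?thesis
    by (simp add: Suc_le_eq card_gt_0_iff)
qed simp

section \<open>Domination degrees in a corona\<close>

text \<open>The cheapest choice in every block at once is its centre.\<close>

lemma dom_degree_corona_Inl:
  assumes G1: "pair_graph G1" and G2: "pair_graph G2" "pverts G2 \<noteq> {}" and x: "x \<in> pverts G1"
  shows "dom_degree (corona G1 G2) (Inl x) = card (pverts G1)"
proof (rule dom_degree_eqI[OF pair_graph_corona[OF G1 G2(1)]])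
  let ?D = "Inl ` pverts G1 :: ('a + 'a \<times> 'b) set"
  show "Inl x \<in> pverts (corona G1 G2)" "Inl x \<in> ?D"
    using x by (auto simp: verts_corona)
  show "minimal_dominating_set (corona G1 G2) ?D"
    unfolding minimal_dominating_set_corona_iff[OF G2(2)] by (auto simp: corona_def)
  show "card ?D = card (pverts G1)"
    by (simp add: card_image)
next
  fix E assume E: "minimal_dominating_set (corona G1 G2) E"
  then have sub: "E \<subseteq> pverts (corona G1 G2)"
    by (simp add: minimal_dominating_set_def dominating_set_def)
  have "card (pverts G1) = (\<Sum>x\<in>pverts G1. 1)"
    by simp
  also have "\<dots> \<le> card E"
    unfolding card_corona_subset[OF G1 G2(1) sub]
    by (rule sum_mono, rule minimal_corona_block_ge_1[OF G2 E])
  finally show "card (pverts G1) \<le> card E" .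
qed

text \<open>
  A copy of \<open>y\<close> in a minimal dominating set forbids the centre of its block, so the trace on this
  copy of \<open>G2\<close> is itself a competitor for the domination degree of \<open>y\<close>. An optimal one together with
  the centres of all other blocks attains the bound.
\<close>

lemma dom_degree_corona_Inr:
  assumes G1: "pair_graph G1" and G2: "pair_graph G2"
    and x: "x \<in> pverts G1" and y: "y \<in> pverts G2"
  shows "dom_degree (corona G1 G2) (Inr (x, y)) = dom_degree G2 y + (card (pverts G1) - 1)"
proof -
  interpret G1: pair_graph G1 by fact
  have ne: "pverts G2 \<noteq> {}" using y by blast
  obtain T where T: "minimal_dominating_set G2 T" "y \<in> T" "card T = dom_degree G2 y"
    using dom_degree_attained[OF G2 y] .
  let ?D = "Inl ` (pverts G1 - {x}) \<union> (\<lambda>t. Inr (x, t)) ` T"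
  have card_split: "card E = (if Inl x \<in> E then 1 else 0) + card (copy_trace E x) +
      (\<Sum>z\<in>pverts G1 - {x}. (if Inl z \<in> E then 1 else 0) + card (copy_trace E z))"
    if "E \<subseteq> pverts (corona G1 G2)" for E
    unfolding card_corona_subset[OF G1 G2 that]
    using x by (simp add: sum.remove[of "pverts G1" x])
  have card_rest: "card (pverts G1) - 1 = (\<Sum>z\<in>pverts G1 - {x}. 1)"
    using x by simp
  have trace: "copy_trace ?D z = (if z = x then T else {})" for z
    by auto
  have "T \<subseteq> pverts G2"
    using T(1) by (simp add: minimal_dominating_set_def dominating_set_def)
  then have sub: "?D \<subseteq> pverts (corona G1 G2)"
    using x by (auto simp: verts_corona)
  show ?thesis
  proof (rule dom_degree_eqI[OF pair_graph_corona[OF G1 G2]])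
    show "Inr (x, y) \<in> pverts (corona G1 G2)" "Inr (x, y) \<in> ?D"
      using x y T(2) by (auto simp: verts_corona)
    have "if Inl z \<in> ?D then copy_trace ?D z = {} else minimal_dominating_set G2 (copy_trace ?D z)"
      if "z \<in> pverts G1" for z
      unfolding trace using that T(1) by auto
    with sub show "minimal_dominating_set (corona G1 G2) ?D"
      unfolding minimal_dominating_set_corona_iff[OF ne] by blast
    have "(\<Sum>z\<in>pverts G1 - {x}. (if Inl z \<in> ?D then 1 else 0) + card (copy_trace ?D z))
        = (\<Sum>z\<in>pverts G1 - {x}. 1)"
      unfolding trace by (rule sum.cong) auto
    moreover have "Inl x \<notin> ?D"
      by auto
    ultimately show "card ?D = dom_degree G2 y + (card (pverts G1) - 1)"
      unfolding card_split[OF sub] card_rest trace using T(3) by simp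
  next
    fix E assume E: "minimal_dominating_set (corona G1 G2) E" and yE: "Inr (x, y) \<in> E"
    then have subE: "E \<subseteq> pverts (corona G1 G2)"
      by (simp add: minimal_dominating_set_def dominating_set_def)
    have "minimal_dominating_set G2 (copy_trace E x)"
      using E yE x mem_copy_trace unfolding minimal_dominating_set_corona_iff[OF ne]
      by (metis empty_iff)
    then have "dom_degree G2 y \<le> card (copy_trace E x)"
      using dom_degree_le_card[OF G2 y] yE by simp
    moreover have "(\<Sum>z\<in>pverts G1 - {x}. 1)
        \<le> (\<Sum>z\<in>pverts G1 - {x}. (if Inl z \<in> E then 1 else 0) + card (copy_trace E z))"
      by (rule sum_mono, rule minimal_corona_block_ge_1[OF G2 ne E]) simp
    ultimately show "dom_degree G2 y + (card (pverts G1) - 1) \<le> card E"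
      unfolding card_split[OF subE] card_rest by linarith
  qed
qed

theorem theorem3p27:
  fixes G1 :: "'a pair_pre_digraph" and G2 :: "'b pair_pre_digraph"
    and a :: "nat \<Rightarrow> 'a" and b :: "nat \<Rightarrow> 'b" and n m :: nat
  assumes "pair_graph G1" and "pverts G1 \<noteq> {}"
    and "pair_graph G2" and "pverts G2 \<noteq> {}"
    and "bij_betw a {1..n} (pverts G1)"
    and "bij_betw b {1..m} (pverts G2)"
  shows "(\<forall>i \<in> {1..n}. dom_degree (corona G1 G2) (Inl (a i)) = n) \<and>
         (\<forall>i \<in> {1..n}. \<forall>j \<in> {1..m}.
            dom_degree (corona G1 G2) (Inr (a i, b j)) = dom_degree G2 (b j) + (n - 1))"
proof -
  have "card (pverts G1) = n"
    using bij_betw_same_card[OF assms(5)] by simp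
  then show ?thesis
    using dom_degree_corona_Inl[OF assms(1,3,4)] dom_degree_corona_Inr[OF assms(1,3)]
      bij_betwE[OF assms(5)] bij_betwE[OF assms(6)] by simp
qed

end
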